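(* Let $T$ be a regular tree of degree $d\ge 3$ rooted at a vertex $v_0$, and let $g:T\to T$ be a $C$-quasi-isometry. Then there exist a constant $D>0$ (a natural number) and a $D$-deep mixed-subtree quasi-isometry $f:T\to T$ such that $g$ and $f$ are at bounded distance. Moreover, if $g(v_0)=v_0$, then $D$ can be chosen to depend only on $T$ and $C$.
   Context: Trees. Trees have edges of length exactly $1$, and $d(\cdot,\cdot)$ is the path metric; maps $T\to T$ are regarded as maps on the vertex set. A regular tree of degree $d$ is a tree in which every vertex (including the root) has exactly $d$ neighbours ($d$ finite). Let $T$ be a tree rooted at $v_0$. A vertex $v$ is a descendant of $w$ (and $w$ an ancestor of $v$) if $w$ lies on the geodesic from $v_0$ to $v$ (so $w$ is a descendant of itself); $T_w$ denotes the subtree of all descendants of $w$, and $T_w^k=\{v\in T_w : d(w,v)\le k\}$. A vertex $v\in T_w$ with $d(v,w)=D$ is a $D$-child of $w$. The parent $p(v)$ of $v\neq v_0$ is the neighbour of $v$ on the geodesic to $v_0$, and $p(v_0)=v_0$. For a finite subtree $S$ of $T$, the boundary $\partial S$ is the set of vertices $v\in T\setminus S$ with $p(v)\in S$. Quasi-isometries. For a metric space $(X,d)$ and $C\ge 1$, a map $f:X\to X$ is a $C$-quasi-isometry if $\frac{d(x,y)}{C}-C\le d(f(x),f(y))\le C\,d(x,y)+C$ for all $x,y\in X$, and there exists some constant $D'$ such that every $y\in X$ satisfies $d(y,f(x))\le D'$ for some $x\in X$. Two maps $f,g:X\to X$ are at bounded distance if there is a constant $R$ with $d(f(x),g(x))\le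 R$ for all $x\in X$. $D$-deep mixed-subtree quasi-isometries. Let $T$ be a regular tree of degree $d\ge 3$ rooted at $v_0$ and let $D\ge 1$ be a natural number. Inductively construct functions $f_i:T_{v_0}^{iD}\to T$, $i\ge 0$, as follows. Set $f_0(v_0)=v_0$. Given $f_i$, define $f_{i+1}$ by: $f_{i+1}(x)=f_i(x)$ for $x\in T_{v_0}^{iD}$; and for every vertex $v$ of the form $v=f_i(x)$ with $d(v_0,x)=iD$, let $X=\{x_1,\dots,x_k\}$ be the set of all vertices $x_j$ with $d(v_0,x_j)=iD$ and $f_i(x_j)=v$, let $B_v$ be the set of all $D$-children of vertices in $X$, and choose any function $f_v':B_v\to T_v$ such that (1) $\mathrm{Im}(f_v')=\partial S_v$ for some finite subtree $S_v$ of $T_v$ containing $v$; and (2) if $f_v'(w)=f_v'(w')$, then $w$ and $w'$ are $D$-children of the same vertex $x_j\in X$. Then set $f_{i+1}|_{B_v}=f_v'$, and $f_{i+1}(w)=v$ for all $w\in T_{x_j}^{D-1}$ and all $x_j\in X$. (The choice of $f_v'$ is made separately at each stage $i$.) The functions $f_i$ agree on common domains, so they define a map $f:T\to T$. Any map $f$ obtained in this way is called a $D$-deep mixed-subtree quasi-isometry. *)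

theory Defs
  imports Complex_Main
begin

text \<open>
  A graph is given by its adjacency relation \<open>adj\<close>; its vertex set is the whole type \<open>'v\<close>.
  Walks are nonempty vertex lists, so a walk with \<open>Suc n\<close> entries has \<open>n\<close> edges.
\<close>

definition walk :: "('v \<Rightarrow> 'v \<Rightarrow> bool) \<Rightarrow> 'v \<Rightarrow> 'v list \<Rightarrow> 'v \<Rightarrow> bool" where
  "walk adj x p y \<longleftrightarrow> p \<noteq> [] \<and> hd p = x \<and> last p = y \<and> successively adj p"

definition is_cycle :: "('v \<Rightarrow> 'v \<Rightarrow> bool) \<Rightarrow> 'v list \<Rightarrow> bool" where
  "is_cycle adj p \<longleftrightarrow>
     3 \<le> length p \<and> distinct p \<and> successively adj p \<and> adj (last p) (hd p)"

definition tree :: "('v \<Rightarrow> 'v \<Rightarrow> bool) \<Rightarrow> bool" where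
  "tree adj \<longleftrightarrow>
     symp adj \<and> irreflp adj \<and> (\<forall>x y. \<exists>p. walk adj x p y) \<and> \<not> (\<exists>p. is_cycle adj p)"

definition regular_tree :: "('v \<Rightarrow> 'v \<Rightarrow> bool) \<Rightarrow> nat \<Rightarrow> bool" where
  "regular_tree adj d \<longleftrightarrow>
     tree adj \<and> (\<forall>v. finite {u. adj v u} \<and> card {u. adj v u} = d)"

definition path_dist :: "('v \<Rightarrow> 'v \<Rightarrow> bool) \<Rightarrow> 'v \<Rightarrow> 'v \<Rightarrow> nat" where
  "path_dist adj x y = (LEAST n. \<exists>p. walk adj x p y \<and> length p = Suc n)"

definition geodesic :: "('v \<Rightarrow> 'v \<Rightarrow> bool) \<Rightarrow> 'v \<Rightarrow> 'v list \<Rightarrow> 'v \<Rightarrow> bool" where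
  "geodesic adj x p y \<longleftrightarrow> walk adj x p y \<and> length p = Suc (path_dist adj x y)"


text \<open>In the following, \<open>v0\<close> is the root.\<close>

definition descendants :: "('v \<Rightarrow> 'v \<Rightarrow> bool) \<Rightarrow> 'v \<Rightarrow> 'v \<Rightarrow> 'v set" where
  "descendants adj v0 w = {v. \<exists>p. geodesic adj v0 p v \<and> w \<in> set p}"

definition descendants_upto :: "('v \<Rightarrow> 'v \<Rightarrow> bool) \<Rightarrow> 'v \<Rightarrow> 'v \<Rightarrow> nat \<Rightarrow> 'v set" where
  "descendants_upto adj v0 w k = {v \<in> descendants adj v0 w. path_dist adj w v \<le> k}"

definition deep_children :: "('v \<Rightarrow> 'v \<Rightarrow> bool) \<Rightarrow> 'v \<Rightarrow> nat \<Rightarrow> 'v \<Rightarrow> 'v set" where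
  "deep_children adj v0 D w = {v \<in> descendants adj v0 w. path_dist adj v w = D}"

definition parent :: "('v \<Rightarrow> 'v \<Rightarrow> bool) \<Rightarrow> 'v \<Rightarrow> 'v \<Rightarrow> 'v" where
  "parent adj v0 v =
     (if v = v0 then v0 else THE u. adj v u \<and> (\<exists>p. geodesic adj v0 p v \<and> u \<in> set p))"

definition finite_subtree :: "('v \<Rightarrow> 'v \<Rightarrow> bool) \<Rightarrow> 'v set \<Rightarrow> bool" where
  "finite_subtree adj S \<longleftrightarrow>
     finite S \<and> S \<noteq> {} \<and> (\<forall>x\<in>S. \<forall>y\<in>S. \<exists>p. walk adj x p y \<and> set p \<subseteq> S)"

definition boundary :: "('v \<Rightarrow> 'v \<Rightarrow> bool) \<Rightarrow> 'v \<Rightarrow> 'v set \<Rightarrow> 'v set" where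
  "boundary adj v0 S = {v. v \<notin> S \<and> parent adj v0 v \<in> S}"


definition quasi_isometry :: "('a \<Rightarrow> 'a \<Rightarrow> real) \<Rightarrow> real \<Rightarrow> ('a \<Rightarrow> 'a) \<Rightarrow> bool" where
  "quasi_isometry dst C f \<longleftrightarrow>
     (\<forall>x y. dst x y / C - C \<le> dst (f x) (f y) \<and> dst (f x) (f y) \<le> C * dst x y + C) \<and>
     (\<exists>D'. \<forall>y. \<exists>x. dst y (f x) \<le> D')"

definition bounded_distance :: "('a \<Rightarrow> 'a \<Rightarrow> real) \<Rightarrow> ('a \<Rightarrow> 'a) \<Rightarrow> ('a \<Rightarrow> 'a) \<Rightarrow> bool" where
  "bounded_distance dst f g \<longleftrightarrow> (\<exists>R. \<forall>x. dst (f x) (g x) \<le> R)"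

abbreviation tree_metric :: "('v \<Rightarrow> 'v \<Rightarrow> bool) \<Rightarrow> 'v \<Rightarrow> 'v \<Rightarrow> real" where
  "tree_metric adj \<equiv> (\<lambda>x y. real (path_dist adj x y))"


text \<open>
  \<open>mixed_choice adj v0 D X v h\<close>: the function \<open>h\<close> is an admissible choice of \<open>f'\<^sub>v\<close>, where \<open>X\<close>
  is the set of all vertices of the current level that are mapped to \<open>v\<close>. Only the values
  of \<open>h\<close> on the set \<open>B\<^sub>v\<close> of \<open>D\<close>-children of vertices in \<open>X\<close> matter.
\<close>

definition mixed_choice ::
  "('v \<Rightarrow> 'v \<Rightarrow> bool) \<Rightarrow> 'v \<Rightarrow> nat \<Rightarrow> 'v set \<Rightarrow> 'v \<Rightarrow> ('v \<Rightarrow> 'v) \<Rightarrow> bool" where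
  "mixed_choice adj v0 D X v h \<longleftrightarrow>
     (let B = (\<Union>x\<in>X. deep_children adj v0 D x) in
        h ` B \<subseteq> descendants adj v0 v \<and>
        (\<exists>S. finite_subtree adj S \<and> S \<subseteq> descendants adj v0 v \<and> v \<in> S \<and>
             h ` B = boundary adj v0 S) \<and>
        (\<forall>w\<in>B. \<forall>w'\<in>B. h w = h w' \<longrightarrow>
             (\<exists>x\<in>X. w \<in> deep_children adj v0 D x \<and> w' \<in> deep_children adj v0 D x)))"

text \<open>
  The stages \<open>f\<^sub>i\<close> and \<open>f\<^sub>i\<^sub>+\<^sub>1\<close> are partial functions; they are represented by total functions
  \<open>F\<close> and \<open>F'\<close> of which only the values at distance at most \<open>i * D\<close>, respectively
  \<open>Suc i * D\<close>, from the root are used.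
\<close>

definition mixed_step ::
  "('v \<Rightarrow> 'v \<Rightarrow> bool) \<Rightarrow> 'v \<Rightarrow> nat \<Rightarrow> nat \<Rightarrow> ('v \<Rightarrow> 'v) \<Rightarrow> ('v \<Rightarrow> 'v) \<Rightarrow> bool" where
  "mixed_step adj v0 D i F F' \<longleftrightarrow>
     (\<forall>x \<in> descendants_upto adj v0 v0 (i * D). F' x = F x) \<and>
     (\<forall>v \<in> F ` {x. path_dist adj v0 x = i * D}.
        let X = {x. path_dist adj v0 x = i * D \<and> F x = v} in
          (\<exists>h. mixed_choice adj v0 D X v h \<and>
               (\<forall>x\<in>X. \<forall>w \<in> deep_children adj v0 D x. F' w = h w)) \<and>
          (\<forall>x\<in>X. \<forall>w \<in> descendants_upto adj v0 x (D - 1). F' w = v))"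

definition mixed_subtree_qi ::
  "('v \<Rightarrow> 'v \<Rightarrow> bool) \<Rightarrow> 'v \<Rightarrow> nat \<Rightarrow> ('v \<Rightarrow> 'v) \<Rightarrow> bool" where
  "mixed_subtree_qi adj v0 D f \<longleftrightarrow>
     1 \<le> D \<and>
     (\<exists>F :: nat \<Rightarrow> 'v \<Rightarrow> 'v.
        F 0 v0 = v0 \<and>
        (\<forall>i. mixed_step adj v0 D i (F i) (F (Suc i))) \<and>
        (\<forall>i. \<forall>x \<in> descendants_upto adj v0 v0 (i * D). f x = F i x))"

end

theory Submission
  imports Defs
begin

text \<open>
  Assume that \<open>g\<close> fixes the root, write \<open>u \<preceq> w\<close> if \<open>w\<close> is a descendant of \<open>u\<close>, and let
  \<open>meet x\<close> be the deepest common ancestor of \<open>g (T\<^sub>x)\<close>. The image under \<open>g\<close> of a path makes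
  jumps of length at most \<open>2 C\<close>, so it passes within \<open>2 C\<close> of every vertex that separates its
  endpoints. If \<open>u \<preceq> g x\<close> but not \<open>u \<preceq> g y\<close> for some \<open>y\<close> below \<open>x\<close>, then the image of the
  geodesic from the root to \<open>y\<close> is near \<open>u\<close> both before and after \<open>x\<close>, so \<open>u\<close> is near \<open>g x\<close>;
  hence \<open>meet x\<close> is within a constant of \<open>g x\<close>.

  The vertices \<open>meet y\<close>, with \<open>y\<close> on one level, need not form an antichain; replacing \<open>meet x\<close>
  by the topmost such \<open>meet y\<close> above it gives \<open>top_meet x\<close>, which is still within a constant
  of \<open>g x\<close> because \<open>x\<close> and \<open>y\<close> have the same depth. The image of a level under \<open>top_meet\<close> is
  an antichain, and every vertex of sufficiently large depth has an ancestor in it because \<open>g\<close> is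
  coarsely surjective. If \<open>D\<close> is large compared to the constants, then vertices with the same
  image under \<open>top_meet\<close> are at distance less than \<open>D\<close>. On the levels \<open>i D\<close> this gives the
  conditions on the choices \<open>f'\<^sub>v\<close>, with \<open>S\<^sub>v\<close> the part of \<open>T\<^sub>v\<close> above the next antichain.

  A map that moves the root is changed at the root, at the price of a larger \<open>C\<close>.
\<close>

section \<open>Walks and path distance\<close>

lemma walk_snoc:
  "walk adj x (p @ [y]) z \<longleftrightarrow>
     z = y \<and> (p = [] \<and> x = y \<or> (\<exists>c. walk adj x p c \<and> adj c y))"
  by (cases "p = []") (auto simp: walk_def successively_append_iff)

lemma walk_Cons:
  "walk adj x (a # p) z \<longleftrightarrow>
     x = a \<and> (p = [] \<and> z = a \<or> (\<exists>c. adj a c \<and> walk adj c p z))"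
  by (auto simp: walk_def successively_Cons)

text \<open>Trades vertex lists for relational powers, so that distances can be treated by induction
  on the exponent.\<close>

lemma ex_walk_iff_relpowp:
  "(\<exists>p. walk adj x p y \<and> length p = Suc n) \<longleftrightarrow> (adj ^^ n) x y"
proof (induction n arbitrary: y)
  case 0
  show ?case
    by (auto simp: length_Suc_conv walk_def)
next
  case (Suc n)
  have "(\<exists>p. walk adj x p y \<and> length p = Suc (Suc n)) \<longleftrightarrow>
        (\<exists>p z. walk adj x (p @ [z]) y \<and> length p = Suc n)" (is "?L = ?R")
  proof
    assume ?L
    then obtain p where p: "walk adj x p y" "length p = Suc (Suc n)"
      by blast
    then have "p = butlast p @ [last p]"
      by (metis append_butlast_last_id list.size(3) nat.distinct(1))
    moreover have "length (butlast p) = Suc n"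
      using p by simp
    ultimately show ?R
      using p by metis
  next
    assume ?R
    then show ?L
      by (metis length_append_singleton)
  qed
  also have "\<dots> \<longleftrightarrow> (\<exists>c. (\<exists>p. walk adj x p c \<and> length p = Suc n) \<and> adj c y)"
    by (auto simp: walk_snoc)
  also have "\<dots> \<longleftrightarrow> (adj ^^ Suc n) x y"
    by (auto simp: Suc.IH)
  finally show ?case .
qed

lemma path_dist_eq_Least: "path_dist adj x y = (LEAST n. (adj ^^ n) x y)"
  by (simp add: path_dist_def ex_walk_iff_relpowp)

lemma path_dist_le: "(adj ^^ n) x y \<Longrightarrow> path_dist adj x y \<le> n"
  by (simp add: path_dist_eq_Least Least_le)

lemma rtranclp_walk:
  assumes "(\<lambda>a b. adj a b \<and> b \<in> S)\<^sup>*\<^sup>* x y" "x \<in> S"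
  shows "\<exists>p. walk adj x p y \<and> set p \<subseteq> S"
  using assms
proof (induction rule: rtranclp_induct)
  case base
  have "walk adj x [x] x"
    by (simp add: walk_def)
  then show ?case
    using base by (intro exI[of _ "[x]"]) simp
next
  case (step y z)
  then obtain p where "walk adj x p y" "set p \<subseteq> S"
    by blast
  then have "walk adj x (p @ [z]) z \<and> set (p @ [z]) \<subseteq> S"
    using step by (auto simp: walk_snoc)
  then show ?case
    by blast
qed

lemma walk_rtranclp:
  assumes "walk adj x p y" "set p \<subseteq> S"
  shows "(\<lambda>a b. adj a b \<and> b \<in> S)\<^sup>*\<^sup>* x y"
  using assms
proof (induction p arbitrary: y rule: rev_induct)
  case (snoc z p)
  then show ?case
    by (auto simp: walk_snoc intro: rtranclp.rtrancl_into_rtrancl)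
qed (simp add: walk_def)

text \<open>Loop erasure: if the new first vertex already occurs on the walk, the walk is cut back
  to that occurrence.\<close>

lemma rtranclp_distinct_walk:
  assumes "(\<lambda>a b. adj a b \<and> b \<in> S)\<^sup>*\<^sup>* x y" "x \<in> S"
  shows "\<exists>p. walk adj x p y \<and> set p \<subseteq> S \<and> distinct p"
  using assms
proof (induction rule: converse_rtranclp_induct)
  case base
  then show ?case
    by (intro exI[of _ "[y]"]) (simp add: walk_def)
next
  case (step x c)
  then obtain p where p: "walk adj c p y" "set p \<subseteq> S" "distinct p"
    by blast
  show ?case
  proof (cases "x \<in> set p")
    case True
    then obtain q r where q: "p = q @ x # r"
      by (meson split_list)
    then have "walk adj x (x # r) y"
      using p(1) by (auto simp: walk_def successively_append_iff)
    then show ?thesis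
      using p q by (intro exI[of _ "x # r"]) auto
  next
    case False
    then have "walk adj x (x # p) y"
      using p step by (auto simp: walk_Cons)
    then show ?thesis
      using False p step.prems by (intro exI[of _ "x # p"]) auto
  qed
qed


section \<open>Rooted trees\<close>

locale rooted_tree =
  fixes adj :: "'v \<Rightarrow> 'v \<Rightarrow> bool" and v0 :: 'v
  assumes tree: "tree adj"
begin

abbreviation depth where "depth \<equiv> path_dist adj v0"
abbreviation par where "par \<equiv> parent adj v0"
abbreviation anc (infix "\<preceq>" 50) where "u \<preceq> w \<equiv> w \<in> descendants adj v0 u"

lemma adj_sym: "adj x y \<longleftrightarrow> adj y x"
  using tree by (auto simp: tree_def symp_def)

lemma not_adj_self: "\<not> adj x x"
  using tree by (auto simp: tree_def irreflp_def)

lemma relpowp_path_dist: "(adj ^^ path_dist adj x y) x y"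
proof -
  obtain p where p: "walk adj x p y"
    using tree unfolding tree_def by blast
  then have "length p = Suc (length p - 1)"
    by (cases p) (auto simp: walk_def)
  then have "\<exists>n. (adj ^^ n) x y"
    using p ex_walk_iff_relpowp[of adj x y] by blast
  then show ?thesis
    unfolding path_dist_eq_Least by (rule LeastI_ex)
qed

lemma relpowp_sym: "(adj ^^ n) x y \<Longrightarrow> (adj ^^ n) y x"
proof (induction n arbitrary: y)
  case (Suc n)
  then show ?case
    by (metis adj_sym relpowp_Suc_E relpowp_Suc_I2)
qed auto

lemma path_dist_commute: "path_dist adj x y = path_dist adj y x"
  by (meson order_antisym path_dist_le relpowp_path_dist relpowp_sym)

lemma path_dist_triangle: "path_dist adj x z \<le> path_dist adj x y + path_dist adj y z"
  using relpowp_path_dist[of x y] relpowp_path_dist[of y z]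
  by (intro path_dist_le) (auto simp: relpowp_add)

lemma path_dist_self [simp]: "path_dist adj x x = 0"
  using path_dist_le[of 0 adj x x] by simp

lemma path_dist_eq_0_iff [simp]: "path_dist adj x y = 0 \<longleftrightarrow> x = y"
  using relpowp_path_dist[of x y] by auto

lemma path_dist_adj: "adj x y \<Longrightarrow> path_dist adj x y \<le> 1"
  by (rule path_dist_le) auto

lemma adj_depth_le: "adj x y \<Longrightarrow> depth y \<le> Suc (depth x)"
  using path_dist_triangle[of v0 y x] path_dist_adj[of x y] by simp

text \<open>Otherwise a repetition-free walk from \<open>u\<close> to \<open>u'\<close> that avoids
  \<open>v\<close> closes up through \<open>v\<close> to a cycle. This is where acyclicity
  enters.\<close>

lemma no_bypass:
  assumes "adj v u" "adj v u'" "(\<lambda>a b. adj a b \<and> b \<in> - {v})\<^sup>*\<^sup>* u u'"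
  shows "u = u'"
proof (rule ccontr)
  assume "u \<noteq> u'"
  have "u \<noteq> v"
    using assms not_adj_self by auto
  then obtain p where p: "walk adj u p u'" "set p \<subseteq> - {v}" "distinct p"
    using rtranclp_distinct_walk[OF assms(3)] by auto
  have "length p \<noteq> 1"
    using p \<open>u \<noteq> u'\<close> by (auto simp: walk_def length_Suc_conv)
  moreover have "p \<noteq> []"
    using p by (auto simp: walk_def)
  ultimately have "length p \<ge> 2"
    by (cases p) (auto simp: Suc_le_eq)
  then have "is_cycle adj (v # p)"
    using p assms adj_sym by (auto simp: is_cycle_def walk_def successively_Cons)
  then show False
    using tree by (auto simp: tree_def)
qed

section \<open>Geodesics from the root and parents\<close>

lemma geodesic_snoc:
  assumes "geodesic adj v0 (p @ [y]) z" "p \<noteq> []"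
  shows "z = y" "\<exists>c. geodesic adj v0 p c \<and> adj c y \<and> depth y = Suc (depth c)"
proof -
  have w: "walk adj v0 (p @ [y]) z" and l: "length p = depth z"
    using assms by (auto simp: geodesic_def)
  show z: "z = y"
    using w by (simp add: walk_snoc)
  obtain c where c: "walk adj v0 p c" "adj c y"
    using w assms(2) by (auto simp: walk_snoc)
  have lp: "length p = Suc (length p - 1)"
    using assms(2) by (cases p) auto
  then have "depth c \<le> length p - 1"
    using c ex_walk_iff_relpowp path_dist_le by metis
  moreover have "depth y \<le> Suc (depth c)"
    using c adj_depth_le by simp
  ultimately have "depth y = Suc (depth c)" "length p = Suc (depth c)"
    using l lp z by auto
  then show "\<exists>c. geodesic adj v0 p c \<and> adj c y \<and> depth y = Suc (depth c)"
    using c by (auto simp: geodesic_def)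
qed

lemma geodesic_depth_less:
  assumes "geodesic adj v0 p y" "x \<in> set p" "x \<noteq> y"
  shows "depth x < depth y"
  using assms
proof (induction p arbitrary: y rule: rev_induct)
  case (snoc z p)
  then have "p \<noteq> []"
    by (auto simp: geodesic_def walk_def)
  with geodesic_snoc[OF snoc.prems(1)] obtain c where
    "y = z" "geodesic adj v0 p c" "depth z = Suc (depth c)"
    by auto
  with snoc show ?case
    by (cases "x = c") force+
qed simp

lemma geodesic_exists: "\<exists>p. geodesic adj v0 p y"
  using relpowp_path_dist[of v0 y] ex_walk_iff_relpowp[of adj v0 y]
  by (auto simp: geodesic_def)

text \<open>Depth increases along a geodesic from the root, so the geodesics to \<open>u\<close> and
  \<open>u'\<close> avoid \<open>v\<close>, and together they would bypass it. The inequalities are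
  non-strict so that comparison with the parent also excludes edges between vertices of equal
  depth.\<close>

lemma lower_neighbour_unique:
  assumes "adj v u" "adj v u'" "depth u \<le> depth v" "depth u' \<le> depth v"
  shows "u = u'"
proof -
  let ?R = "\<lambda>a b. adj a b \<and> b \<in> - {v}"
  have from_root: "\<exists>p. walk adj v0 p w \<and> set p \<subseteq> - {v}"
    if "adj v w" "depth w \<le> depth v" for w
  proof -
    obtain p where p: "geodesic adj v0 p w"
      using geodesic_exists by blast
    have "v \<notin> set p"
      using geodesic_depth_less[OF p, of v] that not_adj_self by auto
    then show ?thesis
      using p by (auto simp: geodesic_def)
  qed
  obtain p where p: "walk adj v0 p u" "set p \<subseteq> - {v}"
    using from_root assms by blast
  obtain q where q: "walk adj v0 q u'" "set q \<subseteq> - {v}"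
    using from_root assms by blast
  have "walk adj u (rev p) v0"
    using p(1) by (auto simp: walk_def successively_rev hd_rev last_rev adj_sym)
  then have "?R\<^sup>*\<^sup>* u v0" "?R\<^sup>*\<^sup>* v0 u'"
    using walk_rtranclp[of adj u "rev p" v0 "- {v}"] walk_rtranclp[OF q] p by auto
  then show ?thesis
    using no_bypass assms by (meson rtranclp_trans)
qed

lemma geodesic_penultimate:
  assumes "geodesic adj v0 p v" "v \<noteq> v0"
  obtains q where "p = q @ [v]" "geodesic adj v0 q (par v)"
    "adj v (par v)" "depth v = Suc (depth (par v))"
proof -
  have p: "p \<noteq> []" "last p = v" "hd p = v0"
    using assms by (auto simp: geodesic_def walk_def)
  then obtain q where q: "p = q @ [v]"
    by (metis append_butlast_last_id)
  with p assms have "q \<noteq> []"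
    by auto
  then obtain c where c: "geodesic adj v0 q c" "adj c v" "depth v = Suc (depth c)"
    using geodesic_snoc(2) assms q by blast
  have "c \<in> set q"
    using c by (auto simp: geodesic_def walk_def)
  have "par v = (THE u. adj v u \<and> (\<exists>p. geodesic adj v0 p v \<and> u \<in> set p))"
    using assms by (simp add: parent_def)
  also have "\<dots> = c"
  proof (rule the_equality)
    show "adj v c \<and> (\<exists>p. geodesic adj v0 p v \<and> c \<in> set p)"
      using c q assms \<open>c \<in> set q\<close> by (auto simp: adj_sym)
  next
    fix u assume u: "adj v u \<and> (\<exists>p. geodesic adj v0 p v \<and> u \<in> set p)"
    then have "depth u \<le> depth v"
      using geodesic_depth_less not_adj_self by (metis less_imp_le)
    then show "u = c"
      using lower_neighbour_unique[of v u c] u c by (auto simp: adj_sym)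
  qed
  finally show ?thesis
    using that q c adj_sym by auto
qed

lemma par_root [simp]: "par v0 = v0"
  by (simp add: parent_def)

lemma adj_par: "v \<noteq> v0 \<Longrightarrow> adj v (par v)"
  using geodesic_exists geodesic_penultimate by metis

lemma Suc_depth_par:
  assumes "v \<noteq> v0"
  shows "Suc (depth (par v)) = depth v"
proof -
  obtain p where "geodesic adj v0 p v"
    using geodesic_exists by blast
  with assms show ?thesis
    by (auto elim: geodesic_penultimate)
qed

lemma depth_par [simp]: "depth (par v) = depth v - 1"
  using Suc_depth_par[of v] by (cases "v = v0") auto

lemma adj_iff_par: "adj x y \<longleftrightarrow> x \<noteq> v0 \<and> y = par x \<or> y \<noteq> v0 \<and> x = par y"
proof
  assume xy: "adj x y"
  have *: "w = par z" "z \<noteq> v0" if "adj z w" "depth w \<le> depth z" for z w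
  proof -
    show "z \<noteq> v0"
      using that not_adj_self by auto
    then show "w = par z"
      using lower_neighbour_unique[of z w "par z"] adj_par that by auto
  qed
  show "x \<noteq> v0 \<and> y = par x \<or> y \<noteq> v0 \<and> x = par y"
    using *[of x y] *[of y x] xy adj_sym by (meson linear)
next
  assume "x \<noteq> v0 \<and> y = par x \<or> y \<noteq> v0 \<and> x = par y"
  then show "adj x y"
    using adj_par adj_sym by blast
qed

lemma depth_par_funpow [simp]: "depth ((par ^^ k) v) = depth v - k"
  by (induction k) auto

lemma par_funpow_root [simp]: "(par ^^ k) v0 = v0"
  by (induction k) auto

lemma geodesic_set: "geodesic adj v0 p v \<Longrightarrow> set p = {u. \<exists>k. u = (par ^^ k) v}"
proof (induction "depth v" arbitrary: p v)
  case 0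
  then have "length p = 1" "hd p = v0" "v0 = v"
    by (auto simp: geodesic_def walk_def)
  then show ?case
    by (auto simp: length_Suc_conv)
next
  case (Suc n)
  then have "v \<noteq> v0"
    by auto
  with Suc obtain q where q: "p = q @ [v]" "geodesic adj v0 q (par v)"
    "depth v = Suc (depth (par v))"
    by (metis geodesic_penultimate)
  then have "set p = insert v {u. \<exists>k. u = (par ^^ k) (par v)}"
    using Suc.hyps(1)[of "par v" q] Suc.hyps(2) by simp
  also have "\<dots> = {u. \<exists>k. u = (par ^^ k) v}"
  proof -
    have "(\<exists>k. u = (par ^^ k) v) \<longleftrightarrow> u = v \<or> (\<exists>k. u = (par ^^ k) (par v))" for u
      by (metis funpow_0 funpow_simps_right(2) comp_apply not0_implies_Suc)
    then show ?thesis
      by blast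
  qed
  finally show ?case .
qed

section \<open>The ancestor order\<close>

lemma anc_iff: "u \<preceq> v \<longleftrightarrow> (\<exists>k. u = (par ^^ k) v)"
  using geodesic_exists[of v] geodesic_set[of _ v] by (fastforce simp: descendants_def)

lemma anc_refl [simp]: "u \<preceq> u"
  unfolding anc_iff by (rule exI[of _ 0]) simp

lemma anc_trans [trans]: "u \<preceq> v \<Longrightarrow> v \<preceq> w \<Longrightarrow> u \<preceq> w"
  unfolding anc_iff by (metis comp_apply funpow_add)

lemma anc_depth_le: "u \<preceq> v \<Longrightarrow> depth u \<le> depth v"
  by (auto simp: anc_iff)

text \<open>Since \<open>par\<close> fixes the root, the exponent in \<open>anc_iff\<close> is not
  unique; the difference of the depths is a canonical choice.\<close>

lemma anc_eq:
  assumes "u \<preceq> v"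
  shows "u = (par ^^ (depth v - depth u)) v"
proof -
  obtain k where k: "u = (par ^^ k) v"
    using assms by (auto simp: anc_iff)
  show ?thesis
  proof (cases "k \<le> depth v")
    case True
    with k show ?thesis by auto
  next
    case False
    then have "depth u = 0" "depth ((par ^^ (depth v - depth u)) v) = 0"
      using k by auto
    then show ?thesis
      by (metis path_dist_eq_0_iff)
  qed
qed

lemma anc_same_depth: "u \<preceq> v \<Longrightarrow> depth u = depth v \<Longrightarrow> u = v"
  using anc_eq by fastforce

lemma anc_antisym: "u \<preceq> v \<Longrightarrow> v \<preceq> u \<Longrightarrow> u = v"
  by (meson anc_depth_le anc_same_depth order_antisym)

lemma anc_comparable:
  assumes "u \<preceq> w" "v \<preceq> w" "depth u \<le> depth v"
  shows "u \<preceq> v"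
proof -
  have "depth v \<le> depth w"
    using assms anc_depth_le by blast
  then have "depth w - depth u = (depth v - depth u) + (depth w - depth v)"
    using assms by simp
  then have "u = (par ^^ (depth v - depth u)) v"
    using anc_eq[OF assms(1)] anc_eq[OF assms(2)] by (metis comp_apply funpow_add)
  then show ?thesis
    by (auto simp: anc_iff)
qed

lemma par_anc [simp]: "par v \<preceq> v"
  unfolding anc_iff by (rule exI[of _ 1]) simp

lemma root_anc [simp]: "v0 \<preceq> v"
  unfolding anc_iff
  by (rule exI[of _ "depth v"]) (metis depth_par_funpow diff_self_eq_0 path_dist_eq_0_iff)

lemma anc_root_iff [simp]: "u \<preceq> v0 \<longleftrightarrow> u = v0"
  by (auto simp: anc_iff)

lemma anc_par: "u \<preceq> v \<Longrightarrow> u \<noteq> v \<Longrightarrow> u \<preceq> par v"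
  unfolding anc_iff by (metis funpow_0 funpow_simps_right(2) comp_apply not0_implies_Suc)

lemma ancestor_at:
  assumes "n \<le> depth v"
  obtains u where "u \<preceq> v" "depth u = n"
proof
  show "(par ^^ (depth v - n)) v \<preceq> v"
    by (auto simp: anc_iff)
  show "depth ((par ^^ (depth v - n)) v) = n"
    using assms by simp
qed

lemma path_dist_anc:
  assumes "u \<preceq> v"
  shows "path_dist adj u v = depth v - depth u"
proof (rule order_antisym)
  show "depth v - depth u \<le> path_dist adj u v"
    using path_dist_triangle[of v0 v u] by simp
  have "path_dist adj u v \<le> k" if "u = (par ^^ k) v" for k
    using that
  proof (induction k arbitrary: u)
    case (Suc k)
    have "path_dist adj (par ((par ^^ k) v)) ((par ^^ k) v) \<le> 1"
      using adj_par path_dist_adj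
      by (metis adj_sym le_numeral_extra(3) nat_le_linear par_root path_dist_self zero_le)
    with Suc.IH[OF refl] Suc.prems show ?case
      using path_dist_triangle[of u v "(par ^^ k) v"] by simp
  qed simp
  then show "path_dist adj u v \<le> depth v - depth u"
    using anc_eq[OF assms] by blast
qed

lemma path_dist_anc':
  assumes "u \<preceq> v"
  shows "path_dist adj v u = depth v - depth u"
  using path_dist_anc[OF assms] by (subst path_dist_commute)

lemma path_dist_anc_mono:
  assumes "u \<preceq> v" "v \<preceq> w"
  shows "path_dist adj v u \<le> path_dist adj u w"
  using path_dist_anc'[OF assms(1)] path_dist_anc[OF anc_trans[OF assms]]
    anc_depth_le[OF assms(2)] by simp

text \<open>A walk can leave the subtree below \<open>u\<close> only through \<open>u\<close>
  itself: every other vertex of the subtree has its parent and its children in it.\<close>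

lemma crossing:
  assumes "u \<preceq> a" "\<not> u \<preceq> b"
  shows "path_dist adj a u \<le> path_dist adj a b"
proof -
  have "\<exists>m\<le>n. (adj ^^ m) a u" if "(adj ^^ n) a b" "\<not> u \<preceq> b" for n b
    using that
  proof (induction n arbitrary: b)
    case 0
    with assms show ?case by auto
  next
    case (Suc n)
    then obtain c where c: "(adj ^^ n) a c" "adj c b"
      by auto
    show ?case
    proof (cases "u \<preceq> c")
      case True
      have "c = u"
      proof (rule ccontr)
        assume "c \<noteq> u"
        then have "u \<preceq> par c"
          using True anc_par by blast
        moreover have "u \<preceq> b" if "c = par b"
          using True that anc_trans par_anc by blast
        ultimately show False
          using c(2) Suc.prems(2) adj_iff_par by blast
      qed
      with c show ?thesis by (intro exI[of _ n]) simp
    next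
      case False
      with Suc.IH c(1) obtain m where "m \<le> n" "(adj ^^ m) a u" by blast
      then show ?thesis by (intro exI[of _ m]) simp
    qed
  qed
  from this[OF relpowp_path_dist assms(2)] obtain m
    where "m \<le> path_dist adj a b" "(adj ^^ m) a u"
    by blast
  then show ?thesis
    using path_dist_le[of m adj a u] by simp
qed

end


locale leafless_tree = rooted_tree +
  assumes finite_neighbours: "finite {u. adj v u}"
    and two_neighbours: "2 \<le> card {u. adj v u}"
begin

lemma finite_ball: "finite {u. depth u \<le> n}"
proof (induction n)
  case 0
  have "{u. depth u \<le> 0} = {v0}" by auto
  then show ?case by simp
next
  case (Suc n)
  have "{u. depth u \<le> Suc n} \<subseteq> insert v0 (\<Union>w\<in>{u. depth u \<le> n}. {u. adj w u})"
  proof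
    fix u assume "u \<in> {u. depth u \<le> Suc n}"
    then have "u = v0 \<or> depth (par u) \<le> n \<and> adj (par u) u"
      using adj_par adj_sym by auto
    then show "u \<in> insert v0 (\<Union>w\<in>{u. depth u \<le> n}. {u. adj w u})"
      by auto
  qed
  then show ?case
    by (rule finite_subset) (use Suc finite_neighbours in auto)
qed

text \<open>Of two neighbours at most one is the parent, so every vertex has a child.\<close>

lemma descendant_at: "\<exists>w. u \<preceq> w \<and> depth w = depth u + k"
proof (induction k)
  case 0
  then show ?case by (intro exI[of _ u]) simp
next
  case (Suc k)
  then obtain w where w: "u \<preceq> w" "depth w = depth u + k"
    by blast
  have "\<not> {c. adj w c} \<subseteq> {par w}"
    using two_neighbours[of w] card_mono[of "{par w}" "{c. adj w c}"] by auto
  then obtain c where c: "c \<noteq> v0" "w = par c"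
    by (auto simp: adj_iff_par)
  have "depth c = depth u + Suc k"
    using Suc_depth_par[OF c(1)] w(2) unfolding c(2) by linarith
  moreover have "u \<preceq> c"
    using w(1) c(2) par_anc anc_trans by blast
  ultimately show ?case
    by blast
qed

text \<open>The witness is the part of the subtree below \<open>v\<close> that has no ancestor in
  \<open>A\<close>. The cut property bounds its depth, and its boundary consists of the members of
  \<open>A\<close> first met on the way down.\<close>

lemma cut_boundary:
  assumes antichain: "\<And>u w. u \<in> A \<Longrightarrow> w \<in> A \<Longrightarrow> u \<preceq> w \<Longrightarrow> u = w"
    and cut: "\<And>u. N \<le> depth u \<Longrightarrow> \<exists>a\<in>A. a \<preceq> u"
    and above: "\<And>a. a \<in> A \<Longrightarrow> \<not> a \<preceq> v"
  shows "\<exists>S. finite_subtree adj S \<and> S \<subseteq> descendants adj v0 v \<and> v \<in> S \<and>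
             boundary adj v0 S = A \<inter> descendants adj v0 v"
proof (intro exI conjI)
  define S where "S = {u. v \<preceq> u \<and> (\<forall>a\<in>A. \<not> a \<preceq> u)}"
  let ?R = "\<lambda>a b. adj a b \<and> b \<in> S"
  show vS: "v \<in> S" and "S \<subseteq> descendants adj v0 v"
    using above by (auto simp: S_def)
  have par_S: "par u \<in> S" if "u \<in> S" "u \<noteq> v" for u
  proof -
    have "v \<preceq> par u"
      using that anc_par by (auto simp: S_def)
    then show ?thesis
      using that anc_trans[OF _ par_anc[of u]] by (auto simp: S_def)
  qed
  \<comment> \<open>Connectedness of \<open>S\<close> is obtained by joining any two of its vertices
    through \<open>v\<close>.\<close>
  have down: "?R\<^sup>*\<^sup>* v u" and up: "?R\<^sup>*\<^sup>* u v" if "u \<in> S" for u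
  proof -
    have "?R\<^sup>*\<^sup>* v u \<and> ?R\<^sup>*\<^sup>* u v"
      using that
    proof (induction "depth u" arbitrary: u rule: less_induct)
      case less
      show ?case
      proof (cases "u = v")
        case False
        then have p: "par u \<in> S"
          using less par_S by blast
        have "u \<noteq> v0"
          using False less.prems by (auto simp: S_def)
        then have a: "adj u (par u)" "adj (par u) u" and "depth (par u) < depth u"
          using adj_par adj_sym Suc_depth_par by (blast, blast, fastforce)
        then have "?R\<^sup>*\<^sup>* v (par u) \<and> ?R\<^sup>*\<^sup>* (par u) v"
          using less.hyps p by blast
        moreover have "?R (par u) u" "?R u (par u)"
          using a p less.prems by auto
        ultimately show ?thesis
          using rtranclp.rtrancl_into_rtrancl[of ?R v "par u" u]
            converse_rtranclp_into_rtranclp[of ?R u "par u" v] by blast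
      qed simp
    qed
    then show "?R\<^sup>*\<^sup>* v u" "?R\<^sup>*\<^sup>* u v" by auto
  qed
  have "S \<subseteq> {u. depth u \<le> N}"
    using cut by (auto simp: S_def) (meson linear)
  then have "finite S"
    using finite_ball finite_subset by blast
  moreover have "\<exists>p. walk adj x p y \<and> set p \<subseteq> S" if "x \<in> S" "y \<in> S" for x y
    using rtranclp_walk[of adj S x y] up[of x] down[of y] that rtranclp_trans[of ?R x v y] by blast
  ultimately show "finite_subtree adj S"
    using vS by (auto simp: finite_subtree_def)
  show "boundary adj v0 S = A \<inter> descendants adj v0 v"
  proof (intro equalityI subsetI)
    fix u assume "u \<in> boundary adj v0 S"
    then have u: "u \<notin> S" "v \<preceq> par u" "\<forall>a\<in>A. \<not> a \<preceq> par u"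
      by (auto simp: boundary_def S_def)
    have "v \<preceq> u"
      using u(2) par_anc anc_trans by blast
    moreover from this obtain a where "a \<in> A" "a \<preceq> u"
      using u(1) by (auto simp: S_def)
    ultimately show "u \<in> A \<inter> descendants adj v0 v"
      using u(3) anc_par by auto
  next
    fix u assume u: "u \<in> A \<inter> descendants adj v0 v"
    then have "u \<noteq> v"
      using above by auto
    then have "v \<preceq> par u" "u \<noteq> v0"
      using u anc_par by auto
    moreover have "\<not> a \<preceq> par u" if "a \<in> A" for a
    proof
      assume a: "a \<preceq> par u"
      then have "a = u"
        using antichain[of a u] that u anc_trans par_anc by blast
      then show False
        using anc_depth_le[OF a] Suc_depth_par[OF \<open>u \<noteq> v0\<close>] by (metis Suc_n_not_le_n)
    qed
    ultimately show "u \<in> boundary adj v0 S"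
      using u anc_refl[of u] unfolding boundary_def S_def by blast
  qed
qed

end


section \<open>Quasi-isometries fixing the root\<close>

locale rooted_tree_qi = leafless_tree +
  fixes C :: real and g :: "'a \<Rightarrow> 'a"
  assumes C_ge_1: "1 \<le> C"
    and qi: "quasi_isometry (tree_metric adj) C g"
    and g_root: "g v0 = v0"
begin

abbreviation dst :: "'a \<Rightarrow> 'a \<Rightarrow> real" where "dst \<equiv> tree_metric adj"

lemma dst_triangle: "dst x z \<le> dst x y + dst y z"
  using path_dist_triangle[of x z y] by linarith

lemma dst_commute: "dst x y = dst y x"
  by (simp add: path_dist_commute)

lemma g_upper: "dst (g x) (g y) \<le> C * dst x y + C"
  using qi by (simp add: quasi_isometry_def)

lemma g_lower: "dst x y \<le> C * (dst (g x) (g y) + C)"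
proof -
  have "dst x y / C - C \<le> dst (g x) (g y)"
    using qi by (simp add: quasi_isometry_def)
  then show ?thesis
    using C_ge_1 by (simp add: field_simps)
qed

lemma g_upper_le: "dst x y \<le> k \<Longrightarrow> dst (g x) (g y) \<le> C * k + C"
  using g_upper[of x y] C_ge_1 by (smt (verit) mult_left_mono)

lemma g_lower_le: "dst (g x) (g y) \<le> k \<Longrightarrow> dst x y \<le> C * (k + C)"
  using g_lower[of x y] C_ge_1 by (smt (verit) mult_left_mono)

lemma g_step: "dst (g x) (g (par x)) \<le> 2 * C"
proof -
  have "dst x (par x) \<le> 1"
    using path_dist_anc'[OF par_anc[of x]] by simp
  then show ?thesis
    using g_upper_le by fastforce
qed

section \<open>Images of geodesics near separating vertices\<close>

lemma dst_crossing: "u \<preceq> a \<Longrightarrow> \<not> u \<preceq> b \<Longrightarrow> dst a u \<le> dst a b"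
  using crossing by simp

text \<open>Climbing from \<open>y\<close>, the first jump that takes the image out of the subtree
  of \<open>u\<close> has length at most \<open>2 * C\<close> and crosses \<open>u\<close>. If there
  is no such jump, the root is reached, and \<open>g v0 = v0\<close> forces
  \<open>u = v0\<close>.\<close>

lemma ray_passes_near:
  assumes "u \<preceq> g y"
  shows "\<exists>z. z \<preceq> y \<and> dst (g z) u \<le> 2 * C"
  using assms
proof (induction "depth y" arbitrary: y rule: less_induct)
  case less
  show ?case
  proof (cases "u \<preceq> g (par y) \<and> y \<noteq> v0")
    case True
    then have "depth (par y) < depth y"
      using Suc_depth_par[of y] by simp
    with less.hyps True obtain z where "z \<preceq> par y" "dst (g z) u \<le> 2 * C"
      by blast
    then show ?thesis
      using anc_trans par_anc by blast
  next
    case False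
    have "dst (g y) u \<le> 2 * C"
    proof (cases "y = v0")
      case True
      then have "u = g y"
        using less.prems g_root by simp
      then show ?thesis
        using C_ge_1 by simp
    next
      case y: False
      then have "dst (g y) u \<le> dst (g y) (g (par y))"
        using False less.prems dst_crossing by blast
      then show ?thesis
        using g_step[of y] by linarith
    qed
    then show ?thesis
      using anc_refl by blast
  qed
qed

lemma segment_passes_near:
  assumes "x \<preceq> y" "u \<preceq> g x" "\<not> u \<preceq> g y"
  shows "\<exists>z. x \<preceq> z \<and> z \<preceq> y \<and> dst (g z) u \<le> 2 * C"
  using assms
proof (induction "depth y" arbitrary: y rule: less_induct)
  case less
  have "x \<noteq> y"
    using less.prems(2,3) by metis
  then have x: "x \<preceq> par y"
    using less.prems(1) anc_par by blast
  have "y \<noteq> v0"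
    using \<open>x \<noteq> y\<close> less.prems(1) anc_root_iff by metis
  then have y: "depth (par y) < depth y"
    using Suc_depth_par[of y] by simp
  show ?case
  proof (cases "u \<preceq> g (par y)")
    case True
    then have "dst (g (par y)) u \<le> dst (g (par y)) (g y)"
      using less.prems dst_crossing by blast
    then have "dst (g (par y)) u \<le> 2 * C"
      using g_step[of y] dst_commute[of "g y" "g (par y)"] by linarith
    then show ?thesis
      using x par_anc by blast
  next
    case False
    then show ?thesis
      using less.hyps[OF y x less.prems(2)] anc_trans[OF _ par_anc[of y]] by blast
  qed
qed

text \<open>The constant of \<open>branching_near\<close>: two images within \<open>2 * C\<close> of
  \<open>u\<close> are \<open>4 * C\<close> apart, the lower bound of \<open>g\<close> turns this
  into a distance in the domain, the upper bound turns it back, and the final \<open>2 * C\<close>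
  leads to \<open>u\<close>.\<close>

definition R where "R = C * (C * (4 * C + C)) + C + 2 * C"

lemma branching_near:
  assumes "x \<preceq> y" "u \<preceq> g x" "\<not> u \<preceq> g y"
  shows "dst (g x) u \<le> R"
proof -
  obtain z where z: "z \<preceq> x" "dst (g z) u \<le> 2 * C"
    using ray_passes_near[OF assms(2)] by blast
  obtain z' where z': "x \<preceq> z'" "dst (g z') u \<le> 2 * C"
    using segment_passes_near[OF assms] by blast
  have "dst (g z) (g z') \<le> 4 * C"
    using z z' dst_triangle[of "g z" "g z'" u] dst_commute[of u "g z'"] by linarith
  then have "dst z z' \<le> C * (4 * C + C)"
    by (rule g_lower_le)
  moreover have "dst x z \<le> dst z z'"
    using path_dist_anc_mono[OF z(1) z'(1)] by simp
  ultimately have "dst x z \<le> C * (4 * C + C)"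
    by linarith
  then have "dst (g x) (g z) \<le> C * (C * (4 * C + C)) + C"
    by (rule g_upper_le)
  then show ?thesis
    using z dst_triangle[of "g x" u "g z"] by (simp add: R_def)
qed

section \<open>Meets of images of subtrees\<close>

definition common where "common x u \<longleftrightarrow> (\<forall>y. x \<preceq> y \<longrightarrow> u \<preceq> g y)"

definition meet where "meet x = (ARG_MAX depth u. common x u)"

text \<open>The maximum exists because \<open>v0\<close> is a candidate and every candidate is an
  ancestor of \<open>g x\<close>, hence no deeper than it.\<close>

lemma common_meet: "common x (meet x)"
  and common_depth_le: "common x u \<Longrightarrow> depth u \<le> depth (meet x)"
proof -
  have "common x v0"
    by (simp add: common_def)
  moreover have "\<forall>u. common x u \<longrightarrow> depth u < Suc (depth (g x))"
    using anc_depth_le by (auto simp: common_def less_Suc_eq_le)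
  ultimately show "common x (meet x)" "common x u \<Longrightarrow> depth u \<le> depth (meet x)"
    using arg_max_nat_lemma[of "common x" v0 depth "Suc (depth (g x))"]
    by (auto simp: meet_def)
qed

lemma meet_anc: "x \<preceq> y \<Longrightarrow> meet x \<preceq> g y"
  using common_meet by (auto simp: common_def)

lemma meet_mono:
  assumes "x \<preceq> y"
  shows "meet x \<preceq> meet y"
proof -
  have "common y (meet x)"
    using common_meet[of x] assms anc_trans by (auto simp: common_def)
  then show ?thesis
    using common_depth_le meet_anc[OF assms] meet_anc[OF anc_refl, of y] anc_comparable by blast
qed

lemma R_nonneg: "0 \<le> R"
  using C_ge_1 by (simp add: R_def)

text \<open>The ancestor of \<open>g x\<close> one level below \<open>meet x\<close> is too deep to
  be common, so some image below \<open>x\<close> avoids its subtree and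
  \<open>branching_near\<close> applies. The extra 1 pays for that level.\<close>

lemma meet_near: "dst (meet x) (g x) \<le> R + 1"
proof (cases "depth (meet x) = depth (g x)")
  case True
  then show ?thesis
    using anc_same_depth[OF meet_anc[OF anc_refl] True] R_nonneg by simp
next
  case False
  then have less: "depth (meet x) < depth (g x)"
    using meet_anc[of x x] anc_depth_le by fastforce
  then obtain u where u: "u \<preceq> g x" "depth u = Suc (depth (meet x))"
    using ancestor_at[of "Suc (depth (meet x))"] by (metis Suc_leI)
  then have "\<not> common x u"
    using common_depth_le by fastforce
  then have "dst (g x) u \<le> R"
    using branching_near u by (auto simp: common_def)
  then show ?thesis
    using u(2) less path_dist_anc'[OF u(1)] path_dist_anc[OF meet_anc[of x x]]
    by simp
qed

definition top_meet where
  "top_meet x = (ARG_MIN depth u. u \<preceq> meet x \<and> (\<exists>y. depth y = depth x \<and> u = meet y))"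

text \<open>All candidates are ancestors of \<open>meet x\<close> and so form a chain; the one of
  least depth is therefore an ancestor of the others.\<close>

lemma top_meet_anc: "top_meet x \<preceq> meet x"
  and top_meet_meet: "\<exists>y. depth y = depth x \<and> top_meet x = meet y"
  and top_meet_least: "depth y = depth x \<Longrightarrow> meet y \<preceq> meet x \<Longrightarrow> top_meet x \<preceq> meet y"
proof -
  let ?P = "\<lambda>u. u \<preceq> meet x \<and> (\<exists>y. depth y = depth x \<and> u = meet y)"
  have "?P (meet x)"
    by auto
  from arg_min_nat_lemma[of ?P, OF this, of depth]
  have *: "?P (top_meet x)" "\<And>u. ?P u \<Longrightarrow> depth (top_meet x) \<le> depth u"
    unfolding top_meet_def by blast+
  then show "top_meet x \<preceq> meet x" "\<exists>y. depth y = depth x \<and> top_meet x = meet y"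
    by auto
  show "top_meet x \<preceq> meet y" if "depth y = depth x" "meet y \<preceq> meet x"
  proof -
    have "?P (meet y)"
      using that by auto
    from *(2)[OF this] show ?thesis
      using anc_comparable[OF _ that(2)] *(1) by blast
  qed
qed

text \<open>Under the hypothesis \<open>top_meet x\<close> is itself a candidate in the minimisation
  that defines \<open>top_meet y\<close>.\<close>

lemma top_meet_antichain:
  assumes "depth x = depth y" "top_meet x \<preceq> top_meet y"
  shows "top_meet x = top_meet y"
proof -
  obtain z where z: "depth z = depth x" "top_meet x = meet z"
    using top_meet_meet by blast
  have "meet z \<preceq> meet y"
    using z assms top_meet_anc anc_trans by metis
  then show ?thesis
    using top_meet_least[of z y] z assms anc_antisym by simp
qed

text \<open>In \<open>top_meet_near\<close>, \<open>R1\<close> bounds the distance between a vertex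
  \<open>y\<close> with \<open>top_meet x = meet y\<close> and an ancestor of \<open>x\<close> whose
  image is near \<open>meet y\<close>; \<open>R2\<close> carries this bound back through
  \<open>g\<close>.\<close>

definition R1 where "R1 = C * (R + 1 + 2 * C + C)"
definition R2 where "R2 = C * R1 + C + 2 * C"

lemma R_le_R2: "R + 1 \<le> R2"
proof -
  have R: "0 \<le> R1"
    using C_ge_1 R_nonneg by (simp add: R1_def)
  have "1 * (R + 1) \<le> R1"
    unfolding R1_def using C_ge_1 R_nonneg by (intro mult_mono) auto
  moreover have "1 * R1 \<le> C * R1"
    using C_ge_1 R by (intro mult_right_mono) auto
  ultimately show "R + 1 \<le> R2"
    using C_ge_1 by (simp add: R2_def)
qed

lemma top_meet_near: "dst (top_meet x) (g x) \<le> R2"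
proof -
  obtain y where y: "depth y = depth x" "top_meet x = meet y"
    using top_meet_meet by blast
  have "top_meet x \<preceq> g x"
    using top_meet_anc[of x] meet_anc[of x x] anc_trans by simp
  then obtain z where z: "z \<preceq> x" "dst (g z) (meet y) \<le> 2 * C"
    using ray_passes_near y by metis
  have "dst (g z) (g y) \<le> R + 1 + 2 * C"
    using z meet_near[of y] dst_triangle[of "g z" "g y" "meet y"] by linarith
  then have "dst z y \<le> R1"
    unfolding R1_def by (rule g_lower_le)
  \<comment> \<open>As \<open>y\<close> lies on the level of \<open>x\<close>, reaching it from
    \<open>z\<close> takes at least as many steps as descending from \<open>z\<close> to
    \<open>x\<close>.\<close>
  moreover have "dst x z \<le> dst z y"
    using path_dist_anc'[OF z(1)] path_dist_triangle[of v0 y z] y(1) by simp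
  ultimately have "dst x z \<le> R1"
    by linarith
  then have "dst (g x) (g z) \<le> C * R1 + C"
    by (rule g_upper_le)
  then show ?thesis
    using z y dst_triangle[of "g x" "meet y" "g z"] dst_commute[of "meet y" "g x"]
    by (simp add: R2_def)
qed

text \<open>A point \<open>g y\<close> close to a deep descendant of \<open>u\<close> lies below
  \<open>u\<close>, and \<open>y\<close> has an ancestor \<open>x\<close> on level \<open>n\<close>.
  Then \<open>top_meet x\<close> and \<open>u\<close> are both ancestors of \<open>g y\<close>, and
  the choice of \<open>N\<close> makes \<open>top_meet x\<close> the higher one.\<close>

lemma top_meet_cut: "\<exists>N. \<forall>u. N \<le> depth u \<longrightarrow> (\<exists>x. depth x = n \<and> top_meet x \<preceq> u)"
proof -
  obtain K :: real where K: "\<And>y. \<exists>x. dst y (g x) \<le> K"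
    using qi by (auto simp: quasi_isometry_def)
  define N where "N = Max ((\<lambda>x. depth (top_meet x)) ` {x. depth x \<le> n})"
  have N: "depth (top_meet x) \<le> N" if "depth x = n" for x
    unfolding N_def using that finite_ball by (intro Max_ge) auto
  have "\<exists>x. depth x = n \<and> top_meet x \<preceq> u" if u: "N \<le> depth u" for u
  proof -
    \<comment> \<open>Exceeding \<open>K\<close> keeps \<open>g y\<close> below \<open>u\<close>;
      the further \<open>C * n + C\<close> forces \<open>y\<close> to have depth at least
      \<open>n\<close>.\<close>
    define k where "k = Suc (nat \<lfloor>\<bar>K\<bar> + C * n + C\<rfloor>)"
    have k: "\<bar>K\<bar> + C * n + C < k"
      unfolding k_def by linarith
    obtain w where w: "u \<preceq> w" "depth w = depth u + k"
      using descendant_at by blast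
    obtain y where y: "dst w (g y) \<le> K"
      using K by blast
    have Cn: "0 \<le> C * n" using C_ge_1 by simp
    have uy: "u \<preceq> g y"
    proof (rule ccontr)
      assume "\<not> u \<preceq> g y"
      then have "dst w u \<le> K"
        using dst_crossing[OF w(1)] y by fastforce
      moreover have "dst w u = k"
        using path_dist_anc'[OF w(1)] w(2) by simp
      ultimately show False
        using k Cn C_ge_1 by linarith
    qed
    have "n \<le> depth y"
    proof (rule ccontr)
      assume "\<not> n \<le> depth y"
      then have "dst v0 y \<le> n"
        by simp
      then have "dst v0 (g y) \<le> C * n + C"
        using g_upper_le[of v0 y n] g_root by simp
      moreover have "k \<le> dst v0 w"
        using w by simp
      ultimately show False
        using k y dst_triangle[of v0 w "g y"] dst_commute[of w "g y"] by linarith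
    qed
    then obtain x where x: "x \<preceq> y" "depth x = n"
      using ancestor_at by blast
    have "top_meet x \<preceq> g y"
      using top_meet_anc meet_anc[OF x(1)] anc_trans by blast
    then show ?thesis
      using anc_comparable[OF _ uy] N[OF x(2)] u x(2) by fastforce
  qed
  then show ?thesis
    by blast
qed

text \<open>The argument of \<open>top_meet\<close> is the ancestor of \<open>x\<close> at the
  largest multiple of \<open>D\<close> not exceeding the depth of \<open>x\<close>.\<close>

definition block_map where "block_map D x = top_meet ((par ^^ (depth x mod D)) x)"

section \<open>Verification of the construction for large \<open>D\<close>\<close>

context
  fixes D :: nat
  assumes D: "C * (2 * R2 + C) < D"
begin

lemma D_pos: "0 < D"
proof -
  have "0 \<le> C * (2 * R2 + C)"
    using C_ge_1 R_nonneg R_le_R2 by simp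
  then show ?thesis
    using D by linarith
qed

lemma near_common_point:
  assumes "dst u (g x) \<le> R2" "dst u (g y) \<le> R2"
  shows "path_dist adj x y < D"
proof -
  have "dst (g x) (g y) \<le> 2 * R2"
    using assms dst_triangle[of "g x" "g y" u] dst_commute[of u "g x"] by linarith
  then have "dst x y \<le> C * (2 * R2 + C)"
    by (rule g_lower_le)
  then show ?thesis
    using D by linarith
qed

text \<open>Leaving the subtree of \<open>x\<close> from \<open>w\<close> means crossing
  \<open>x\<close>, which is already \<open>D\<close> steps away.\<close>

lemma same_block:
  assumes "x \<preceq> w" "depth w = depth x + D" "path_dist adj w w' < D"
  shows "x \<preceq> w'"
  using crossing[OF assms(1), of w'] path_dist_anc'[OF assms(1)] assms(2,3) by fastforce

text \<open>The vertex \<open>y\<close> that realises \<open>top_meet w\<close> need not be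
  \<open>w\<close>, but both images are near the same point, so \<open>y\<close> is still below
  \<open>x\<close> and \<open>meet_mono\<close> applies. Equality would put \<open>x\<close> and
  \<open>w\<close> closer than \<open>D\<close>.\<close>

lemma top_meet_child:
  assumes "x \<preceq> w" "depth w = depth x + D"
  shows "top_meet x \<preceq> top_meet w" "top_meet x \<noteq> top_meet w"
proof -
  obtain y where y: "depth y = depth w" "top_meet w = meet y"
    using top_meet_meet by blast
  have "dst (meet y) (g y) \<le> R2"
    using meet_near[of y] R_le_R2 by linarith
  moreover have "dst (meet y) (g w) \<le> R2"
    using top_meet_near[of w] y(2) by simp
  ultimately have "path_dist adj w y < D"
    using near_common_point by blast
  then have "x \<preceq> y"
    using same_block assms by blast
  then have "top_meet x \<preceq> meet y"
    using top_meet_anc meet_mono anc_trans by blast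
  then show "top_meet x \<preceq> top_meet w"
    using y by simp
  show "top_meet x \<noteq> top_meet w"
  proof
    assume "top_meet x = top_meet w"
    then have "path_dist adj x w < D"
      using near_common_point[OF top_meet_near[of x], of w] top_meet_near[of w] by simp
    then show False
      using path_dist_anc[OF assms(1)] assms(2) by simp
  qed
qed

lemma deep_children_eq: "deep_children adj v0 D x = {w. x \<preceq> w \<and> depth w = depth x + D}"
proof -
  have "path_dist adj w x = D \<longleftrightarrow> depth w = depth x + D" if "x \<preceq> w" for w
    using path_dist_anc'[OF that] anc_depth_le[OF that] by auto
  then show ?thesis
    by (auto simp: deep_children_def)
qed

lemma mixed_choice_top_meet:
  assumes h: "\<And>w. depth w = n + D \<Longrightarrow> h w = top_meet w"
    and x0: "depth x0 = n"
  shows "mixed_choice adj v0 D {x. depth x = n \<and> top_meet x = top_meet x0} (top_meet x0) h"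
proof -
  define v where "v = top_meet x0"
  define X where "X = {x. depth x = n \<and> top_meet x = v}"
  define A where "A = top_meet ` {w. depth w = n + D}"
  define B where "B = (\<Union>x\<in>X. deep_children adj v0 D x)"
  have B: "w \<in> B \<longleftrightarrow> (\<exists>x. x \<preceq> w \<and> depth x = n \<and> top_meet x = v \<and> depth w = n + D)" for w
    by (auto simp: B_def X_def deep_children_eq)
  \<comment> \<open>Ancestors of a common vertex are comparable, so two members of the antichain of
    level \<open>n\<close> above the same \<open>u\<close> coincide.\<close>
  have anc_v: "top_meet x = v" if x: "depth x = n" "top_meet x \<preceq> u" "v \<preceq> u" for x u
  proof -
    consider "top_meet x \<preceq> v" | "v \<preceq> top_meet x"
      using anc_comparable[OF x(2,3)] anc_comparable[OF x(3,2)] linear by blast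
    then show ?thesis
      using top_meet_antichain[of x x0] top_meet_antichain[of x0 x] x(1) x0
      by cases (auto simp: v_def)
  qed
  have anc_x: "\<exists>x. x \<preceq> w \<and> depth x = n \<and> top_meet x \<preceq> top_meet w \<and> top_meet x \<noteq> top_meet w"
    if "depth w = n + D" for w
  proof -
    obtain x where x: "x \<preceq> w" "depth x = n"
      using ancestor_at[of n w] \<open>depth w = n + D\<close> by auto
    then have "depth w = depth x + D"
      using that by simp
    with x show ?thesis
      using top_meet_child by blast
  qed
  have image: "h ` B = A \<inter> descendants adj v0 v"
  proof (intro equalityI subsetI)
    fix u assume "u \<in> h ` B"
    then obtain w x where "x \<preceq> w" "depth x = n" "top_meet x = v" "depth w = n + D" "u = h w"
      using B by blast
    then show "u \<in> A \<inter> descendants adj v0 v"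
      using top_meet_child(1)[where x = x and w = w] h[of w] by (auto simp: A_def)
  next
    fix u assume "u \<in> A \<inter> descendants adj v0 v"
    then obtain w where w: "depth w = n + D" "u = top_meet w" "v \<preceq> top_meet w"
      by (auto simp: A_def)
    then obtain x where x: "x \<preceq> w" "depth x = n" "top_meet x \<preceq> top_meet w"
      using anc_x by blast
    then have "w \<in> B"
      using anc_v[OF x(2,3)] w B by blast
    then show "u \<in> h ` B"
      using h w by (auto intro: rev_image_eqI)
  qed
  obtain N where N: "\<And>u. N \<le> depth u \<Longrightarrow> \<exists>x. depth x = n + D \<and> top_meet x \<preceq> u"
    using top_meet_cut by blast
  have "\<exists>S. finite_subtree adj S \<and> S \<subseteq> descendants adj v0 v \<and> v \<in> S \<and>
            boundary adj v0 S = A \<inter> descendants adj v0 v"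
  proof (rule cut_boundary)
    show "u = w" if "u \<in> A" "w \<in> A" "u \<preceq> w" for u w
      using that top_meet_antichain by (auto simp: A_def)
    show "\<exists>a\<in>A. a \<preceq> u" if "N \<le> depth u" for u
      using N[OF that] by (auto simp: A_def)
    \<comment> \<open>Above \<open>a\<close> lies a strictly higher member of the antichain of level
      \<open>n\<close>; if \<open>a\<close> were above \<open>v\<close>, that member would have to
      be \<open>v\<close>.\<close>
    show "\<not> a \<preceq> v" if aA: "a \<in> A" for a
    proof
      assume a: "a \<preceq> v"
      obtain w where w: "depth w = n + D" "a = top_meet w"
        using aA by (auto simp: A_def)
      obtain x where x: "depth x = n" "top_meet x \<preceq> a" "top_meet x \<noteq> a"
        using anc_x w by blast
      then have "top_meet x = v"
        using anc_v[of x v] a anc_trans anc_refl by blast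
      then show False
        using x a anc_antisym by blast
    qed
  qed
  \<comment> \<open>Equal values put \<open>w\<close> and \<open>w'\<close> closer than
    \<open>D\<close>, too close to lie below different vertices of level \<open>n\<close>.\<close>
  moreover have "\<exists>x\<in>X. w \<in> deep_children adj v0 D x \<and> w' \<in> deep_children adj v0 D x"
    if "w \<in> B" "w' \<in> B" "h w = h w'" for w w'
  proof -
    obtain x where x: "x \<preceq> w" "depth x = n" "top_meet x = v" and w: "depth w = n + D"
      using \<open>w \<in> B\<close> B by blast
    have w': "depth w' = n + D"
      using \<open>w' \<in> B\<close> B by blast
    have "path_dist adj w w' < D"
      using near_common_point[OF top_meet_near[of w], of w'] top_meet_near[of w']
        h[OF w] h[OF w'] that(3) by simp
    then have "x \<preceq> w'"
      using same_block[OF x(1)] w x(2) by simp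
    then show ?thesis
      using x w w' by (auto simp: X_def deep_children_eq)
  qed
  ultimately have "mixed_choice adj v0 D X v h"
    unfolding mixed_choice_def Let_def B_def[symmetric] image by blast
  then show ?thesis
    by (simp add: X_def v_def)
qed

lemma block_map_at: "depth x = i * D \<Longrightarrow> block_map D x = top_meet x"
  by (simp add: block_map_def)

lemma block_map_below:
  assumes "depth x = i * D" "w \<in> descendants_upto adj v0 x (D - 1)"
  shows "block_map D w = top_meet x"
proof -
  have xw: "x \<preceq> w" and "path_dist adj x w \<le> D - 1"
    using assms(2) by (auto simp: descendants_upto_def)
  then have "depth w - depth x < D"
    using path_dist_anc[OF xw] D_pos by simp
  moreover have "depth w = i * D + (depth w - depth x)"
    using anc_depth_le[OF xw] assms(1) by simp
  ultimately have "depth w mod D = depth w - depth x"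
    by (metis mod_less mod_mult_self3)
  then show ?thesis
    using anc_eq[OF xw] by (simp add: block_map_def)
qed

lemma mixed_subtree_qi_block_map: "mixed_subtree_qi adj v0 D (block_map D)"
  unfolding mixed_subtree_qi_def
\<comment> \<open>A constant sequence of stages suffices, because stage \<open>i\<close> is only
  evaluated up to depth \<open>i * D\<close>.\<close>
proof (intro conjI exI[of _ "\<lambda>_. block_map D"] allI ballI)
  show "1 \<le> D"
    using D_pos by simp
  have "top_meet v0 \<preceq> v0"
    using anc_trans[OF top_meet_anc meet_anc[OF anc_refl]] g_root by metis
  then show "block_map D v0 = v0"
    by (simp add: block_map_def)
  show "mixed_step adj v0 D i (block_map D) (block_map D)" for i
    unfolding mixed_step_def Let_def
  proof (intro conjI ballI refl)
    fix v assume "v \<in> block_map D ` {x. depth x = i * D}"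
    then obtain x0 where x0: "depth x0 = i * D" "v = top_meet x0"
      using block_map_at by blast
    have X: "{x. depth x = i * D \<and> block_map D x = v} =
             {x. depth x = i * D \<and> top_meet x = top_meet x0}"
      unfolding x0(2) by (rule Collect_cong) (metis block_map_at)
    have next_level: "block_map D w = top_meet w" if "depth w = i * D + D" for w
      using block_map_at[of w "Suc i"] that by simp
    have "mixed_choice adj v0 D {x. depth x = i * D \<and> block_map D x = v} v (block_map D)"
      unfolding X unfolding x0(2) by (rule mixed_choice_top_meet[OF next_level x0(1)])
    then show "\<exists>h. mixed_choice adj v0 D {x. depth x = i * D \<and> block_map D x = v} v h \<and>
      (\<forall>x\<in>{x. depth x = i * D \<and> block_map D x = v}.
         \<forall>w\<in>deep_children adj v0 D x. block_map D w = h w)"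
      by blast
    show "block_map D w = v"
      if "x \<in> {x. depth x = i * D \<and> block_map D x = v}" "w \<in> descendants_upto adj v0 x (D - 1)"
      for x w
      using block_map_below[of x i w] block_map_at[of x i] that by auto
  qed
qed simp_all

lemma bounded_distance_block_map: "bounded_distance (tree_metric adj) g (block_map D)"
  unfolding bounded_distance_def
proof (intro exI allI)
  fix x
  define a where "a = (par ^^ (depth x mod D)) x"
  have a: "a \<preceq> x"
    by (auto simp: a_def anc_iff)
  have "depth x - depth a \<le> depth x mod D"
    by (simp add: a_def)
  also have "\<dots> \<le> D"
    using D_pos by (simp add: less_imp_le)
  finally have "dst x a \<le> D"
    using path_dist_anc'[OF a] by simp
  then have "dst (g x) (g a) \<le> C * D + C"
    by (rule g_upper_le)
  then show "dst (g x) (block_map D x) \<le> C * D + C + R2"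
    using top_meet_near[of a] dst_triangle[of "g x" "top_meet a" "g a"]
      dst_commute[of "top_meet a" "g a"] by (simp add: block_map_def a_def)
qed

end

end


section \<open>Moving the root\<close>

text \<open>Of two distinct points at most one is \<open>v\<close>, so a distance between images
  changes by at most the displacement of \<open>g v\<close>.\<close>

lemma (in rooted_tree) quasi_isometry_fun_upd:
  assumes "1 \<le> C" and g: "quasi_isometry (tree_metric adj) C g"
  shows "quasi_isometry (tree_metric adj) (C + path_dist adj (g v) w) (g(v := w))"
proof -
  let ?d = "tree_metric adj" and ?g = "g(v := w)"
  define K where "K = ?d (g v) w"
  have K: "0 \<le> K"
    by (simp add: K_def)
  have tri: "?d x z \<le> ?d x y + ?d y z" and comm: "?d x y = ?d y x" for x y z
    using path_dist_triangle[of x z y] path_dist_commute[of x y] by linarith+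
  have near: "?d (g x) (?g x) \<le> K" for x
    by (simp add: K_def)
  have bounds: "?d x y / (C + K) - (C + K) \<le> ?d (?g x) (?g y) \<and>
                ?d (?g x) (?g y) \<le> (C + K) * ?d x y + (C + K)" for x y
  proof (cases "x = y")
    case True
    then show ?thesis
      using assms(1) K by simp
  next
    case False
    then have "?d (g x) (?g x) + ?d (g y) (?g y) \<le> K"
      by (auto simp: K_def)
    then have *: "?d (?g x) (?g y) \<le> ?d (g x) (g y) + K" "?d (g x) (g y) \<le> ?d (?g x) (?g y) + K"
      using tri[of "?g x" "?g y" "g x"] tri[of "g x" "?g y" "g y"] comm[of "?g x" "g x"]
        tri[of "g x" "g y" "?g x"] tri[of "?g x" "g y" "?g y"] comm[of "?g y" "g y"]
      by linarith+
    have "?d x y / C - C \<le> ?d (g x) (g y)" "?d (g x) (g y) \<le> C * ?d x y + C"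
      using g by (auto simp: quasi_isometry_def)
    moreover have "?d x y / (C + K) \<le> ?d x y / C"
      using assms(1) K by (intro divide_left_mono) auto
    moreover have "C * ?d x y \<le> (C + K) * ?d x y"
      using K by (intro mult_right_mono) auto
    ultimately show ?thesis
      using * by linarith
  qed
  obtain M where M: "\<And>y. \<exists>x. ?d y (g x) \<le> M"
    using g by (auto simp: quasi_isometry_def)
  have "\<exists>x. ?d y (?g x) \<le> M + K" for y
  proof -
    obtain x where "?d y (g x) \<le> M"
      using M by blast
    then have "?d y (?g x) \<le> M + K"
      using tri[of y "?g x" "g x"] near[of x] by linarith
    then show ?thesis ..
  qed
  with bounds show ?thesis
    unfolding quasi_isometry_def K_def[symmetric] by blast
qed

theorem lemma3p2:
  fixes adj :: "'v \<Rightarrow> 'v \<Rightarrow> bool" and d :: nat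
  assumes "regular_tree adj d" and "3 \<le> d"
  shows "(\<forall>(v0 :: 'v) (C :: real) (g :: 'v \<Rightarrow> 'v).
            1 \<le> C \<and> quasi_isometry (tree_metric adj) C g \<longrightarrow>
            (\<exists>(D :: nat) f. 0 < D \<and> mixed_subtree_qi adj v0 D f \<and>
                            bounded_distance (tree_metric adj) g f)) \<and>
         (\<forall>C :: real. 1 \<le> C \<longrightarrow>
            (\<exists>D :: nat. 0 < D \<and>
               (\<forall>(v0 :: 'v) (g :: 'v \<Rightarrow> 'v).
                  quasi_isometry (tree_metric adj) C g \<and> g v0 = v0 \<longrightarrow>
                  (\<exists>f. mixed_subtree_qi adj v0 D f \<and>
                       bounded_distance (tree_metric adj) g f))))"
proof -
  have rooted: "rooted_tree adj"
    using assms by unfold_locales (simp add: regular_tree_def)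
  have leafless: "leafless_tree adj"
    using assms rooted
    by (simp add: leafless_tree_def leafless_tree_axioms_def regular_tree_def)
  have fixing_root: "\<exists>D>0. \<forall>v0 g. quasi_isometry (tree_metric adj) C g \<and> g v0 = v0 \<longrightarrow>
      (\<exists>f. mixed_subtree_qi adj v0 D f \<and> bounded_distance (tree_metric adj) g f)"
    if "1 \<le> C" for C :: real
  proof (intro exI conjI allI impI)
    \<comment> \<open>Outside the locale \<open>R2\<close> takes only \<open>C\<close> as an
      argument, so \<open>D\<close> can be fixed before \<open>v0\<close> and
      \<open>g\<close>.\<close>
    let ?L = "C * (2 * rooted_tree_qi.R2 C + C)"
    let ?D = "Suc (nat \<lfloor>?L\<rfloor>)"
    fix v0 g assume g: "quasi_isometry (tree_metric adj) C g \<and> g v0 = v0"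
    interpret rooted_tree_qi adj v0 C g
      using leafless that g
      by (simp add: rooted_tree_qi_def rooted_tree_qi_axioms_def)
    have D: "?L < ?D"
      by linarith
    show "mixed_subtree_qi adj v0 ?D (block_map ?D)"
      using D by (rule mixed_subtree_qi_block_map)
    show "bounded_distance (tree_metric adj) g (block_map ?D)"
      using D by (rule bounded_distance_block_map)
  qed simp
  have "\<exists>D f. 0 < D \<and> mixed_subtree_qi adj v0 D f \<and> bounded_distance (tree_metric adj) g f"
    if "1 \<le> C" and g: "quasi_isometry (tree_metric adj) C g" for v0 C g
  proof -
    \<comment> \<open>The new constant involves \<open>g v0\<close>, so the \<open>D\<close>
      obtained here may vary with \<open>g\<close> and \<open>v0\<close>.\<close>
    let ?C = "C + path_dist adj (g v0) v0" and ?g = "g(v0 := v0)"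
    interpret rooted_tree adj v0
      by (rule rooted)
    have "1 \<le> ?C" "quasi_isometry (tree_metric adj) ?C ?g" "?g v0 = v0"
      using that quasi_isometry_fun_upd by auto
    then obtain D f where D: "0 < D" "mixed_subtree_qi adj v0 D f"
      and f: "bounded_distance (tree_metric adj) ?g f"
      using fixing_root[of ?C] by blast
    obtain r where r: "\<And>x. tree_metric adj (?g x) (f x) \<le> r"
      using f by (auto simp: bounded_distance_def)
    have "tree_metric adj (g x) (f x) \<le> path_dist adj (g v0) v0 + r" for x
    proof -
      have "path_dist adj (g x) (?g x) \<le> path_dist adj (g v0) v0"
        by simp
      then show ?thesis
        using path_dist_triangle[of "g x" "f x" "?g x"] r[of x] by linarith
    qed
    then have "bounded_distance (tree_metric adj) g f"
      unfolding bounded_distance_def by blast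
    with D show ?thesis
      by blast
  qed
  with fixing_root show ?thesis
    by blast
qed

end
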